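(* Let $q$ be a prime power and $n,m,k$ positive integers with $n\le m$, and let $s=\max\{\lfloor n/2^{k-1}\rfloor,1\}$. Then $L_{\mathrm{rk}}(n,m,k,q)\le n-s+1$.
   Context: $\mathbb{F}_{q^m}$ is the degree-$m$ extension of $\mathbb{F}_q$. Rank weight of $\mathbf v=(v_1,\dots,v_n)\in\mathbb{F}_{q^m}^n$: $\mathrm{w}(\mathbf v)=\dim_{\mathbb{F}_q}\langle v_1,\dots,v_n\rangle_{\mathbb{F}_q}$. An $[n,k]_{q^m/q}$ code is a $k$-dimensional $\mathbb{F}_{q^m}$-subspace $\mathcal C\subseteq\mathbb{F}_{q^m}^n$ with weight spectrum $\mathrm{WS}(\mathcal C)=\{\mathrm{w}(\mathbf c):\mathbf c\in\mathcal C\setminus\{\mathbf 0\}\}$. $L_{\mathrm{rk}}(n,m,k,q)$ is the maximum of $|\mathrm{WS}(\mathcal C)|$ over all $[n,k]_{q^m/q}$ codes $\mathcal C$. *)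

theory Defs
  imports "HOL-Analysis.Cartesian_Space" "HOL-Number_Theory.Prime_Powers"
begin

text \<open>
  A field extension is given by a field homomorphism \<open>\<iota>\<close> from the base field \<open>'k\<close> into \<open>'a\<close>;
  it makes \<open>'a\<close> a vector space over \<open>'k\<close>.
\<close>

locale field_extension =
  fixes \<iota> :: "'k::field \<Rightarrow> 'a::field"
  assumes emb_add: "\<iota> (x + y) = \<iota> x + \<iota> y"
    and emb_mult: "\<iota> (x * y) = \<iota> x * \<iota> y"
    and emb_one: "\<iota> 1 = 1"
begin

sublocale ext: vector_space "\<lambda>c x. \<iota> c * x"
  by unfold_locales (simp_all add: emb_add emb_mult emb_one algebra_simps)

definition ext_degree :: nat where
  "ext_degree = ext.dim UNIV"

definition rank_weight :: "'a ^ 'n \<Rightarrow> nat" where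
  "rank_weight v = ext.dim (ext.span (range (\<lambda>i. v $ i)))"

definition weight_spectrum :: "('a ^ 'n) set \<Rightarrow> nat set" where
  "weight_spectrum C = rank_weight ` (C - {0})"

definition codes :: "nat \<Rightarrow> ('a ^ 'n) set set" where
  "codes k = {C. vec.subspace C \<and> vec.dim C = k}"

text \<open>
  The length of the codes is \<open>CARD('n)\<close>. If it is less than \<open>k\<close>, there are no codes and
  the maximum over the empty family is 0 by convention.
\<close>

definition L_rk :: "'n::finite itself \<Rightarrow> nat \<Rightarrow> nat" where
  "L_rk _ k =
    (if (codes k :: ('a ^ 'n) set set) = {} then 0
     else Max ((\<lambda>C. card (weight_spectrum C)) ` (codes k :: ('a ^ 'n) set set)))"

lemma codes_nonempty_iff:
  "(codes k :: ('a ^ 'n::finite) set set) \<noteq> {} \<longleftrightarrow> k \<le> CARD('n)"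
proof
  assume "(codes k :: ('a ^ 'n) set set) \<noteq> {}"
  then obtain C :: "('a ^ 'n) set" where "vec.dim C = k"
    by (auto simp: codes_def)
  then show "k \<le> CARD('n)"
    using vec.dim_subset_UNIV[of C] by (simp add: vec.dimension_def card_cart_basis)
next
  assume "k \<le> CARD('n)"
  then obtain B where B: "B \<subseteq> (cart_basis :: ('a ^ 'n) set)" "card B = k"
    by (metis card_cart_basis obtain_subset_with_card_n)
  have "vec.independent B"
    using B(1) independent_cart_basis vec.independent_mono by blast
  then have "vec.span B \<in> (codes k :: ('a ^ 'n) set set)"
    using B(2) by (simp add: codes_def vec.dim_eq_card_independent)
  then show "(codes k :: ('a ^ 'n) set set) \<noteq> {}" by blast
qed

end

end

theory Submission
  imports Defs
begin

text \<open>
  Choose a basis of the code by successive minima: the next vector has least weight \<open>\<delta>\<close> among the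
  codewords outside the span \<open>D\<close> of the previous ones. By subadditivity, the weights on \<open>D\<close> are at
  most the sum \<open>S\<close> of the weights chosen so far, and outside \<open>D\<close> they are at least \<open>\<delta>\<close>, so no
  codeword has weight strictly between \<open>S\<close> and \<open>\<delta>\<close>. Hence \<open>S\<close> can only more than double at the
  price of missing weights, and after \<open>k\<close> steps \<open>2 * (S + 1) \<le> 2 ^ k * (g + 2)\<close> where \<open>g\<close> is the
  number of missing weights found.
\<close>

context finite_dimensional_vector_space
begin

text \<open>\<open>G\<close> records the gaps found so far. They are kept inside
  \<open>{1..n}\<close> as well, since the sum \<open>S\<close> of the chosen weights may exceed
  \<open>n\<close>. The final inequality is tight at \<open>j = 0\<close>, where
  \<open>S = 0\<close> and \<open>G\<close> is empty.\<close>

lemma successive_minima_gaps: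
  fixes w :: "'b \<Rightarrow> nat"
  assumes C: "subspace C"
    and w0: "w 0 = 0"
    and add: "\<And>u v. w (u + v) \<le> w u + w v"
    and scale: "\<And>a v. w (scale a v) \<le> w v"
    and bound: "\<And>v. w v \<le> n"
    and "j \<le> dim C"
  shows "\<exists>D S G. subspace D \<and> D \<subseteq> C \<and> dim D = j \<and> (\<forall>v\<in>D. w v \<le> S) \<and>
    G \<subseteq> {1..n} \<inter> {1..S} \<and> G \<inter> w ` C = {} \<and> 2 * (S + 1) \<le> 2 ^ j * (card G + 2)"
  using \<open>j \<le> dim C\<close>
proof (induction j)
  case 0
  show ?case
    using w0 subspace_0[OF C] by (intro exI[of _ "{0}"] exI[of _ 0] exI[of _ "{}"]) simp
next
  case (Suc j)
  then obtain D S G where D: "subspace D" "D \<subseteq> C" "dim D = j" "\<forall>v\<in>D. w v \<le> S"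
    and G: "G \<subseteq> {1..n} \<inter> {1..S}" "G \<inter> w ` C = {}" "2 * (S + 1) \<le> 2 ^ j * (card G + 2)"
    by auto
  have "C - D \<noteq> {}"
    using D Suc.prems by auto
  then obtain c where c: "c \<in> C - D" and min: "\<And>v. v \<in> C - D \<Longrightarrow> w c \<le> w v"
    using ex_has_least_nat[of "\<lambda>v. v \<in> C - D" _ w] by blast
  let ?D = "span (insert c D)" and ?G = "G \<union> {S<..<w c}"
  have "dim ?D = Suc j"
    using c D by (simp add: dim_insert span_eq_iff[THEN iffD2])
  moreover have "?D \<subseteq> C"
    using c D C by (intro span_minimal) auto
  moreover have "w v \<le> S + w c" if v: "v \<in> ?D" for v
  proof -
    obtain a where "v - scale a c \<in> span D"
      using v span_breakdown_eq by blast
    then have "w (v - scale a c) \<le> S"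
      using D by (simp add: span_eq_iff[THEN iffD2])
    then show ?thesis
      using add[of "v - scale a c" "scale a c"] scale[of a c] by simp
  qed
  moreover have "?G \<subseteq> {1..n} \<inter> {1..S + w c}"
    using G(1) bound[of c] by fastforce
  moreover have "?G \<inter> w ` C = {}"
  proof -
    have "w v \<notin> {S<..<w c}" if "v \<in> C" for v
      using that min[of v] D(4) by (cases "v \<in> D") auto
    then show ?thesis using G(2) by auto
  qed
  moreover have "2 * (S + w c + 1) \<le> 2 ^ Suc j * (card ?G + 2)"
  proof -
    have "finite G" "G \<inter> {S<..<w c} = {}"
      using G(1) finite_subset[OF G(1)] by auto
    then have card: "card ?G = card G + (w c - Suc S)"
      by (simp add: card_Un_disjoint)
    \<comment> \<open>If \<open>w c \<le> S\<close>, the subtraction truncates to 0 and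
      \<open>S + 1\<close> at most doubles. Otherwise equality holds, and the excess over doubling
      is exactly the number of new gaps.\<close>
    have "2 * (S + w c + 1) \<le> 2 * (2 * (S + 1)) + 2 * (w c - Suc S)"
      by simp
    also have "\<dots> \<le> 2 * (2 ^ j * (card G + 2)) + 2 ^ Suc j * (w c - Suc S)"
      using G(3) by (intro add_mono mult_left_mono mult_right_mono) simp_all
    also have "\<dots> = 2 ^ Suc j * (card ?G + 2)"
      by (simp add: card algebra_simps)
    finally show ?thesis .
  qed
  ultimately show ?case
    by (intro exI[of _ ?D] exI[of _ "S + w c"] exI[of _ ?G]) auto
qed

text \<open>At \<open>j = dim C\<close> the chosen vectors span \<open>C\<close>, so attained
  weights and gaps are disjoint subsets of \<open>{1..min n S}\<close>. The growth bound on
  \<open>S\<close> then forces many values up to \<open>n\<close> to be missed.\<close>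

lemma card_subadditive_weights_le:
  fixes w :: "'b \<Rightarrow> nat"
  assumes C: "subspace C"
    and w0: "\<And>v. w v = 0 \<longleftrightarrow> v = 0"
    and add: "\<And>u v. w (u + v) \<le> w u + w v"
    and scale: "\<And>a v. w (scale a v) \<le> w v"
    and bound: "\<And>v. w v \<le> n"
    and "dim C > 0"
  shows "card (w ` (C - {0})) \<le> n - max (n div 2 ^ (dim C - 1)) 1 + 1"
proof -
  let ?W = "w ` (C - {0})"
  obtain D S G where D: "subspace D" "D \<subseteq> C" "dim D = dim C" "\<forall>v\<in>D. w v \<le> S"
    and G: "G \<subseteq> {1..n} \<inter> {1..S}" "G \<inter> w ` C = {}"
      "2 * (S + 1) \<le> 2 ^ dim C * (card G + 2)"
    using successive_minima_gaps[OF C w0[THEN iffD2, OF refl] add scale bound order_refl] by blast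
  obtain i where i: "dim C = Suc i"
    using \<open>dim C > 0\<close> gr0_implies_Suc by blast
  have "D = C"
    using D C by (intro subspace_dim_equal) auto
  then have W: "?W \<subseteq> {1..min n S}"
    using D(4) bound w0 by (auto simp: Suc_le_eq)
  have finite: "finite ?W" "finite G"
    using W G(1) finite_subset[of _ "{1..min n S}"] by auto
  have "card ?W + card G = card (?W \<union> G)"
    using G(2) finite by (intro card_Un_disjoint[symmetric]) auto
  also have "\<dots> \<le> card {1..min n S}"
    using W G(1) by (intro card_mono) auto
  finally have count: "card ?W + card G \<le> min n S"
    by simp
  \<comment> \<open>If \<open>S < n\<close>, the values from \<open>S + 1\<close> to
    \<open>n\<close> are missed too; the factor \<open>2 ^ i\<close> lets them be counted together
    with \<open>G\<close>.\<close>
  have "n - min n S \<le> 2 ^ i * (n - min n S)"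
    by simp
  then have "n + 1 \<le> S + 1 + 2 ^ i * (n - min n S)"
    by linarith
  also have "\<dots> \<le> 2 ^ i * (card G + 2) + 2 ^ i * (n - min n S)"
    using G(3) by (simp add: i)
  also have "\<dots> = 2 ^ i * (card G + 2 + (n - min n S))"
    by (simp add: algebra_simps)
  also have "\<dots> \<le> 2 ^ i * (n - card ?W + 2)"
    using count by (intro mult_left_mono) auto
  finally have "n div 2 ^ i < n - card ?W + 2"
    by (intro less_mult_imp_div_less) (simp add: mult.commute)
  \<comment> \<open>Where the maximum is 1, the claim is just \<open>card ?W \<le> n\<close>, which
    comes from \<open>count\<close>.\<close>
  then show ?thesis
    using count i by (auto simp: max_def)
qed

end

context field_extension
begin

text \<open>A basis can be picked among the finitely many coordinates. It supplies the spanning sets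
  that bound the weights of sums and multiples.\<close>

lemma ex_rank_weight_basis:
  fixes v :: "'a ^ 'n"
  obtains B where "finite B" "card B = rank_weight v" "range (\<lambda>i. v $ i) \<subseteq> ext.span B"
proof -
  obtain B where B: "B \<subseteq> range (\<lambda>i. v $ i)" "range (\<lambda>i. v $ i) \<subseteq> ext.span B"
      "card B = ext.dim (range (\<lambda>i. v $ i))"
    using ext.basis_exists by blast
  moreover from B(1) have "finite B"
    by (rule finite_subset) simp
  ultimately show ?thesis
    using that by (simp add: rank_weight_def)
qed

lemma rank_weight_le_card:
  assumes "finite B" "range (\<lambda>i. v $ i) \<subseteq> ext.span B"
  shows "rank_weight v \<le> card B"
  using assms by (simp add: rank_weight_def ext.dim_le_card)

lemma rank_weight_le_length: "rank_weight (v :: 'a ^ 'n) \<le> CARD('n)"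
proof -
  have "rank_weight v \<le> card (range (\<lambda>i. v $ i))"
    by (intro rank_weight_le_card) (auto intro: ext.span_base)
  also have "\<dots> \<le> CARD('n)"
    by (rule card_image_le) simp
  finally show ?thesis .
qed

lemma rank_weight_add: "rank_weight (u + v) \<le> rank_weight u + rank_weight v"
proof -
  obtain A where A: "finite A" "card A = rank_weight u" "range (\<lambda>i. u $ i) \<subseteq> ext.span A"
    by (rule ex_rank_weight_basis)
  obtain B where B: "finite B" "card B = rank_weight v" "range (\<lambda>i. v $ i) \<subseteq> ext.span B"
    by (rule ex_rank_weight_basis)
  have "u $ i + v $ i \<in> ext.span (A \<union> B)" for i
    using A(3) B(3) ext.span_mono[of A "A \<union> B"] ext.span_mono[of B "A \<union> B"]
    by (intro ext.span_add) auto
  then have "rank_weight (u + v) \<le> card (A \<union> B)"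
    using A B by (intro rank_weight_le_card) auto
  also have "\<dots> \<le> card A + card B"
    by (rule card_Un_le)
  finally show ?thesis
    using A B by simp
qed

lemma rank_weight_scale: "rank_weight (a *s v) \<le> rank_weight v"
proof -
  obtain B where B: "finite B" "card B = rank_weight v" "range (\<lambda>i. v $ i) \<subseteq> ext.span B"
    by (rule ex_rank_weight_basis)
  \<comment> \<open>Multiplication by \<open>a\<close> is linear over the base field, so it carries
    a spanning set of the coordinates of \<open>v\<close> to one for \<open>a *s v\<close>.\<close>
  interpret mult: Vector_Spaces.linear "\<lambda>c x. \<iota> c * x" "\<lambda>c x. \<iota> c * x" "(*) a"
    by unfold_locales (simp_all add: algebra_simps)
  have "range (\<lambda>i. (a *s v) $ i) \<subseteq> ext.span ((*) a ` B)"
    using B(3) mult.span_image[of B] by auto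
  then have "rank_weight (a *s v) \<le> card ((*) a ` B)"
    using B by (intro rank_weight_le_card) auto
  also have "\<dots> \<le> card B"
    using B by (intro card_image_le)
  finally show ?thesis
    using B by simp
qed

lemma rank_weight_eq_0_iff: "rank_weight v = 0 \<longleftrightarrow> v = 0"
proof
  assume "rank_weight v = 0"
  then obtain B where "finite B" "card B = 0" "range (\<lambda>i. v $ i) \<subseteq> ext.span B"
    using ex_rank_weight_basis by metis
  then show "v = 0"
    by (auto simp: vec_eq_iff)
next
  assume "v = 0"
  then have "rank_weight v \<le> card ({} :: 'a set)"
    by (intro rank_weight_le_card) auto
  then show "rank_weight v = 0" by simp
qed

lemma card_weight_spectrum_le:
  fixes C :: "('a ^ 'n) set"
  assumes "C \<in> codes k" "k > 0"
  shows "card (weight_spectrum C) \<le> CARD('n) - max (CARD('n) div 2 ^ (k - 1)) 1 + 1"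
  using assms vec.card_subadditive_weights_le[of C rank_weight "CARD('n)"]
    rank_weight_eq_0_iff rank_weight_add rank_weight_scale rank_weight_le_length
  by (auto simp: codes_def weight_spectrum_def)

lemma L_rk_le:
  assumes "k > 0"
  shows "L_rk TYPE('n::finite) k \<le> CARD('n) - max (CARD('n) div 2 ^ (k - 1)) 1 + 1"
proof (cases "(codes k :: ('a ^ 'n) set set) = {}")
  case False
  let ?cards = "(\<lambda>C. card (weight_spectrum C)) ` (codes k :: ('a ^ 'n) set set)"
  \<comment> \<open>The uniform bound also makes \<open>?cards\<close> finite, as reasoning about
    \<open>Max\<close> requires.\<close>
  have "?cards \<subseteq> {..CARD('n) - max (CARD('n) div 2 ^ (k - 1)) 1 + 1}"
    using card_weight_spectrum_le assms by blast
  then have "Max ?cards \<le> CARD('n) - max (CARD('n) div 2 ^ (k - 1)) 1 + 1"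
    using False finite_subset[of ?cards] by (subst Max_le_iff) auto
  then show ?thesis
    using False by (simp add: L_rk_def)
qed (simp add: L_rk_def)

end

theorem theorem3p9:
  fixes \<iota> :: "'k::{field,finite} \<Rightarrow> 'a::{field,finite}"
    and q n m k s :: nat
  assumes "primepow q" and "n > 0" and "m > 0" and "k > 0" and "n \<le> m"
    and "field_extension \<iota>"
    and "CARD('k) = q"
    and "field_extension.ext_degree \<iota> = m"
    and "CARD('n::finite) = n"
    and "s = max (n div 2 ^ (k - 1)) 1"
  shows "field_extension.L_rk \<iota> TYPE('n) k \<le> n - s + 1"
  using field_extension.L_rk_le[OF assms(6,4), where 'n = 'n] assms(9,10) by simp

end
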